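(* Let $f$ be a tropical entire function and let $a\in\mathbb{R}$. Suppose that the functions $x\mapsto\max(f(x+1),a)$ and $x\mapsto\max(f(x),a)$ have the same roots with the same multiplicities on $\mathbb{R}$. Then there are real constants $A,B$ and a $1$-periodic tropical meromorphic function $\Pi$ such that at least one of the following holds: (a) $f(x)=\Pi(x)+Bx$ for all $x$ close enough to $-\infty$; (b) $f(x)=\Pi(x)+Bx$ for all $x$ close enough to $+\infty$; (c) $f(x)=A\Psi(x)+\Pi(x)+(B-A)x$ for all $x$ with $|x|$ large enough.
   Context: A tropical meromorphic function is a continuous piecewise linear function $f:\mathbb{R}\to\mathbb{R}$ (arbitrary real slopes, points of slope change having no accumulation point in $\mathbb{R}$). For $x_0\in\mathbb{R}$ put $\omega_f(x_0)=\lim_{\varepsilon\to0^+}[f'(x_0+\varepsilon)-f'(x_0-\varepsilon)]$; $x_0$ is a root of $f$ of multiplicity $\omega_f(x_0)$ if $\omega_f(x_0)>0$, and a pole of multiplicity $-\omega_f(x_0)$ if $\omega_f(x_0)<0$. A tropical entire function is a tropical meromorphic function without poles. With $[x]$ the integer part (floor) of $x$, $\Psi(x)=([x]+1)x-\frac12[x]([x]+1)$. *)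

theory Defs
  imports "HOL-Analysis.Analysis"
begin

definition tropical_meromorphic :: "(real \<Rightarrow> real) \<Rightarrow> bool" where
  "tropical_meromorphic f \<longleftrightarrow>
     continuous_on UNIV f \<and>
     (\<exists>S. (\<forall>x. \<not> x islimpt S) \<and>
          (\<forall>u v. {u<..<v} \<inter> S = {} \<longrightarrow>
                 (\<exists>m c. \<forall>x\<in>{u<..<v}. f x = m * x + c)))"

definition tropical_omega :: "(real \<Rightarrow> real) \<Rightarrow> real \<Rightarrow> real" where
  "tropical_omega f x0 = Lim (at_right 0) (\<lambda>\<epsilon>. deriv f (x0 + \<epsilon>) - deriv f (x0 - \<epsilon>))"

text \<open>The last argument of the next two predicates is the multiplicity, an arbitrary
  positive real number.\<close>

definition tropical_root :: "(real \<Rightarrow> real) \<Rightarrow> real \<Rightarrow> real \<Rightarrow> bool" where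
  "tropical_root f x0 m \<longleftrightarrow> tropical_omega f x0 > 0 \<and> m = tropical_omega f x0"

definition tropical_pole :: "(real \<Rightarrow> real) \<Rightarrow> real \<Rightarrow> real \<Rightarrow> bool" where
  "tropical_pole f x0 m \<longleftrightarrow> tropical_omega f x0 < 0 \<and> m = - tropical_omega f x0"

definition tropical_entire :: "(real \<Rightarrow> real) \<Rightarrow> bool" where
  "tropical_entire f \<longleftrightarrow> tropical_meromorphic f \<and> (\<nexists>x0 m. tropical_pole f x0 m)"

definition same_roots_with_multiplicities :: "(real \<Rightarrow> real) \<Rightarrow> (real \<Rightarrow> real) \<Rightarrow> bool" where
  "same_roots_with_multiplicities f g \<longleftrightarrow> (\<forall>x0 m. tropical_root f x0 m \<longleftrightarrow> tropical_root g x0 m)"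

definition Psi :: "real \<Rightarrow> real" where
  "Psi x = (real_of_int \<lfloor>x\<rfloor> + 1) * x - 1/2 * real_of_int \<lfloor>x\<rfloor> * (real_of_int \<lfloor>x\<rfloor> + 1)"

end

theory Submission
  imports Defs
begin

text \<open>The function \<open>g = max f a\<close> has non-negative \<open>\<omega>\<close>, so equality of the roots of \<open>g (x + 1)\<close>
  and \<open>g x\<close> says that \<open>g (x + 1) - g x\<close> has no kinks and hence is affine, \<open>\<alpha> x + \<beta>\<close>. As
  \<open>Psi (x + 1) - Psi x = x + 1\<close>, the function \<open>g x - \<alpha> Psi x - (\<beta> - \<alpha>) x\<close> is 1-periodic. If \<open>f > a\<close>
  near both infinities, this is alternative (c). Otherwise, \<open>f\<close> being convex, \<open>g = a\<close> on an
  interval of length 2, so \<open>\<alpha> = \<beta> = 0\<close> and \<open>g\<close> is periodic, hence equal to \<open>a\<close> everywhere; then \<open>f\<close> is convex and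
  bounded above, hence constant.\<close>

section \<open>One-sided slopes and their arithmetic\<close>

text \<open>Here \<open>m\<close> is the left slope and \<open>n\<close> the right slope. Using
  \<open>min t 0\<close> and \<open>max t 0\<close> puts both sides into one equation on a full
  neighbourhood of 0, so sums and multiples need no case split, and continuity at \<open>x\<close>
  is built in.\<close>

definition slopes_at :: "(real \<Rightarrow> real) \<Rightarrow> real \<Rightarrow> real \<Rightarrow> real \<Rightarrow> bool" where
  "slopes_at f x m n \<longleftrightarrow> (\<forall>\<^sub>F t in nhds 0. f (x + t) = f x + m * min t 0 + n * max t 0)"

lemma slopes_atE:
  assumes "slopes_at f x m n"
  obtains d where "d > 0"
    "\<And>y. \<lbrakk>x \<le> y; y < x + d\<rbrakk> \<Longrightarrow> f y = f x + n * (y - x)"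
    "\<And>y. \<lbrakk>x - d < y; y \<le> x\<rbrakk> \<Longrightarrow> f y = f x + m * (y - x)"
proof -
  obtain d where d: "d > 0"
    "\<And>t. \<bar>t\<bar> < d \<Longrightarrow> f (x + t) = f x + m * min t 0 + n * max t 0"
    using assms unfolding slopes_at_def eventually_nhds_metric by (auto simp: dist_real_def)
  show thesis
  proof
    fix y assume "x \<le> y" "y < x + d"
    then show "f y = f x + n * (y - x)" using d(2)[of "y - x"] by auto
  next
    fix y assume "x - d < y" "y \<le> x"
    then show "f y = f x + m * (y - x)" using d(2)[of "y - x"] by auto
  qed fact
qed

lemma slopes_atI:
  assumes "d > 0"
    "\<And>y. \<lbrakk>x \<le> y; y < x + d\<rbrakk> \<Longrightarrow> f y = f x + n * (y - x)"
    "\<And>y. \<lbrakk>x - d < y; y \<le> x\<rbrakk> \<Longrightarrow> f y = f x + m * (y - x)"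
  shows "slopes_at f x m n"
proof -
  have "f (x + t) = f x + m * min t 0 + n * max t 0" if "\<bar>t\<bar> < d" for t
    using assms(2)[of "x + t"] assms(3)[of "x + t"] that by (cases "t \<ge> 0") auto
  then show ?thesis
    unfolding slopes_at_def eventually_nhds_metric using assms(1) by (auto simp: dist_real_def)
qed

lemma slopes_at_const: "slopes_at (\<lambda>x. c) x 0 0"
  by (simp add: slopes_at_def)

lemma slopes_at_ident: "slopes_at (\<lambda>x. x) x 1 1"
  by (simp add: slopes_at_def min_def max_def)

lemma slopes_at_cmult:
  assumes "slopes_at f x m n"
  shows "slopes_at (\<lambda>x. c * f x) x (c * m) (c * n)"
  using assms unfolding slopes_at_def by (rule eventually_mono) (simp add: algebra_simps)

lemma slopes_at_diff:
  assumes "slopes_at f x m n" "slopes_at g x m' n'"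
  shows "slopes_at (\<lambda>x. f x - g x) x (m - m') (n - n')"
  using assms unfolding slopes_at_def
  by eventually_elim (simp add: algebra_simps)

lemma slopes_at_shift:
  assumes "slopes_at f (x + c) m n"
  shows "slopes_at (\<lambda>x. f (x + c)) x m n"
  using assms unfolding slopes_at_def by (simp add: algebra_simps)

lemma slopes_at_imp_isCont:
  assumes "slopes_at f x m n"
  shows "isCont f x"
proof -
  have "((\<lambda>t. f x + m * min t 0 + n * max t 0) \<longlongrightarrow> f x + m * min 0 0 + n * max 0 0) (at 0)"
    by (intro tendsto_intros)
  moreover have "\<forall>\<^sub>F t in at 0. f x + m * min t 0 + n * max t 0 = f (x + t)"
    using assms unfolding slopes_at_def eventually_at_filter by (auto elim: eventually_mono)
  ultimately have "((\<lambda>t. f (x + t)) \<longlongrightarrow> f x) (at 0)"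
    using Lim_transform_eventually by fastforce
  then show ?thesis by (simp add: isCont_iff)
qed

text \<open>Truncation preserves the order of the slopes. Where f differs from \<open>a\<close>,
  continuity makes the maximum locally f or locally constant; where f meets \<open>a\<close>, the
  slopes become \<open>min m 0\<close> and \<open>max n 0\<close>.\<close>

lemma slopes_at_max_const:
  assumes "slopes_at f x m n" "m \<le> n"
  obtains m' n' where "slopes_at (\<lambda>x. max (f x) a) x m' n'" "m' \<le> n'"
proof -
  have cont: "((\<lambda>t. f (x + t)) \<longlongrightarrow> f x) (nhds 0)"
    using slopes_at_imp_isCont[OF assms(1)]
    by (simp add: isCont_iff tendsto_nhds_iff)
  consider "f x > a" | "f x < a" | "f x = a" by linarith
  then show thesis
  proof cases
    case 1
    have "\<forall>\<^sub>F t in nhds 0. f (x + t) > a" using order_tendstoD(1)[OF cont 1] .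
    with assms(1) have "slopes_at (\<lambda>x. max (f x) a) x m n"
      unfolding slopes_at_def by eventually_elim (use 1 in auto)
    then show thesis using that assms(2) by blast
  next
    case 2
    have "\<forall>\<^sub>F t in nhds 0. f (x + t) < a" using order_tendstoD(2)[OF cont 2] .
    then have "slopes_at (\<lambda>x. max (f x) a) x 0 0"
      unfolding slopes_at_def by eventually_elim (use 2 in auto)
    then show thesis using that by blast
  next
    case 3
    obtain d where d: "d > 0"
      "\<And>y. \<lbrakk>x \<le> y; y < x + d\<rbrakk> \<Longrightarrow> f y = f x + n * (y - x)"
      "\<And>y. \<lbrakk>x - d < y; y \<le> x\<rbrakk> \<Longrightarrow> f y = f x + m * (y - x)"
      using slopes_atE[OF assms(1)] by blast
    have "slopes_at (\<lambda>x. max (f x) a) x (min m 0) (max n 0)"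
    proof (rule slopes_atI[OF d(1)])
      fix y assume "x \<le> y" "y < x + d"
      with d(2)[of y] 3 show "max (f y) a = max (f x) a + max n 0 * (y - x)"
        by (auto simp: max_def mult_nonneg_nonneg mult_nonpos_nonneg zero_le_mult_iff
            mult_le_0_iff)
    next
      fix y assume "x - d < y" "y \<le> x"
      with d(3)[of y] 3 show "max (f y) a = max (f x) a + min m 0 * (y - x)"
        by (auto simp: max_def min_def mult_le_0_iff)
    qed
    then show thesis using that by fastforce
  qed
qed

section \<open>Multiplicities and tropical meromorphic functions in terms of slopes\<close>

lemma DERIV_affine_on_open:
  assumes "open U" "y \<in> U" "\<And>z. z \<in> U \<Longrightarrow> f z = c + m * (z - x)"
  shows "(f has_real_derivative m) (at y)"
proof -
  have "((\<lambda>z. c + m * (z - x)) has_real_derivative m) (at y)"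
    by (auto intro!: derivative_eq_intros)
  then show ?thesis
    by (rule has_field_derivative_transform_within_open[OF _ assms(1,2)]) (simp add: assms(3))
qed

text \<open>For all small positive \<epsilon> the difference of derivatives already equals
  \<open>n - m\<close>, so the limit exists and \<open>Lim\<close> returns it.\<close>

lemma tropical_omega_eq:
  assumes "slopes_at f x m n"
  shows "tropical_omega f x = n - m"
proof -
  obtain d where d: "d > 0"
    "\<And>y. \<lbrakk>x \<le> y; y < x + d\<rbrakk> \<Longrightarrow> f y = f x + n * (y - x)"
    "\<And>y. \<lbrakk>x - d < y; y \<le> x\<rbrakk> \<Longrightarrow> f y = f x + m * (y - x)"
    using slopes_atE[OF assms] by blast
  have "deriv f (x + e) - deriv f (x - e) = n - m" if "0 < e" "e < d" for e
  proof -
    have "(f has_real_derivative n) (at (x + e))"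
      by (rule DERIV_affine_on_open[of "{x<..<x + d}"], use that in simp_all, rule d(2)) auto
    moreover have "(f has_real_derivative m) (at (x - e))"
      by (rule DERIV_affine_on_open[of "{x - d<..<x}"], use that in simp_all, rule d(3)) auto
    ultimately show ?thesis by (simp add: DERIV_imp_deriv)
  qed
  then have "\<forall>\<^sub>F e in at_right 0. n - m = deriv f (x + e) - deriv f (x - e)"
    unfolding eventually_at_right_field using d(1) by metis
  then have "((\<lambda>e. deriv f (x + e) - deriv f (x - e)) \<longlongrightarrow> n - m) (at_right 0)"
    by (rule Lim_transform_eventually[OF tendsto_const])
  then show ?thesis unfolding tropical_omega_def by (intro tendsto_Lim) auto
qed

text \<open>Equal slopes make f affine near each point, so \<open>deriv f\<close> is locally
  constant. A vanishing derivative on a convex set then gives first a global slope \<open>m\<close>,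
  and next a constant \<open>f x - m * x\<close>.\<close>

lemma affine_on_if_no_kinks:
  fixes U :: "real set"
  assumes "open U" "convex U" "\<And>x. x \<in> U \<Longrightarrow> \<exists>m. slopes_at f x m m"
  obtains m c where "\<And>x. x \<in> U \<Longrightarrow> f x = m * x + c"
proof -
  have *: "(f has_real_derivative deriv f x) (at x) \<and> (deriv f has_real_derivative 0) (at x)"
    if x: "x \<in> U" for x
  proof -
    obtain m where m: "slopes_at f x m m" using assms(3)[OF x] by blast
    obtain d where d: "d > 0"
      "\<And>y. \<lbrakk>x \<le> y; y < x + d\<rbrakk> \<Longrightarrow> f y = f x + m * (y - x)"
      "\<And>y. \<lbrakk>x - d < y; y \<le> x\<rbrakk> \<Longrightarrow> f y = f x + m * (y - x)"
      using slopes_atE[OF m] by blast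
    have D: "(f has_real_derivative m) (at y)" if "y \<in> {x - d<..<x + d}" for y
    proof (rule DERIV_affine_on_open[OF _ that])
      fix z assume "z \<in> {x - d<..<x + d}"
      then show "f z = f x + m * (z - x)" using d(2,3)[of z] by (cases "x \<le> z") auto
    qed auto
    have "(deriv f has_real_derivative 0) (at x)"
    proof (rule DERIV_affine_on_open)
      fix y assume "y \<in> {x - d<..<x + d}"
      then show "deriv f y = m + 0 * (y - 0)" using D[THEN DERIV_imp_deriv] by simp
    qed (use d(1) in auto)
    moreover have "(f has_real_derivative deriv f x) (at x)"
      using D[of x] d(1) DERIV_imp_deriv[of f m x] by simp
    ultimately show ?thesis by blast
  qed
  have "\<exists>m. \<forall>x\<in>U. deriv f x = m"
    by (rule has_field_derivative_zero_constant[OF assms(2)])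
      (use * in \<open>blast intro: has_field_derivative_at_within\<close>)
  then obtain m where m: "\<And>x. x \<in> U \<Longrightarrow> deriv f x = m" by blast
  have "\<exists>c. \<forall>x\<in>U. f x - m * x = c"
  proof (rule has_field_derivative_zero_constant[OF assms(2)])
    fix x assume "x \<in> U"
    then have "(f has_real_derivative m) (at x)" using * m by metis
    then have "((\<lambda>x. f x - m * x) has_real_derivative 0) (at x)"
      by (auto intro!: derivative_eq_intros)
    then show "((\<lambda>x. f x - m * x) has_real_derivative 0) (at x within U)"
      by (rule has_field_derivative_at_within)
  qed
  then obtain c where "\<And>x. x \<in> U \<Longrightarrow> f x - m * x = c" by blast
  then show thesis using that[of m c] by (simp add: algebra_simps)
qed

text \<open>Continuity carries the affine formula from \<open>I\<close> to its limit point
  \<open>x\<close>, which allows the intercept to be replaced by the value at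
  \<open>x\<close>.\<close>

lemma affine_extends_to_limit_point:
  fixes f :: "real \<Rightarrow> real"
  assumes "isCont f x" "x islimpt I" "\<And>y. y \<in> I \<Longrightarrow> f y = m * y + c" "y \<in> I"
  shows "f y = f x + m * (y - x)"
proof -
  have "(f \<longlongrightarrow> f x) (at x within I)"
    using assms(1) by (simp add: continuous_at_imp_continuous_at_within continuous_within[symmetric])
  moreover have "(f \<longlongrightarrow> m * x + c) (at x within I)"
  proof (rule Lim_transform_eventually)
    show "((\<lambda>y. m * y + c) \<longlongrightarrow> m * x + c) (at x within I)" by (intro tendsto_intros)
    show "\<forall>\<^sub>F y in at x within I. m * y + c = f y"
      unfolding eventually_at_filter using assms(3) by simp
  qed
  ultimately have "f x = m * x + c"
    using assms(2) tendsto_unique trivial_limit_within by blast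
  then show ?thesis using assms(3,4) by (simp add: algebra_simps)
qed

text \<open>This trades the global definition for a pointwise one. Forwards, a point that is not a
  limit of \<open>S\<close> has a gap of \<open>S\<close> on either side. Backwards, the kinks are
  isolated, and between them f is affine.\<close>

lemma tropical_meromorphic_iff_slopes_at:
  "tropical_meromorphic f \<longleftrightarrow> (\<forall>x. \<exists>m n. slopes_at f x m n)"
proof
  assume f: "tropical_meromorphic f"
  then obtain S where S: "\<And>x. \<not> x islimpt S"
    "\<And>u v. {u<..<v} \<inter> S = {} \<Longrightarrow> \<exists>m c. \<forall>x\<in>{u<..<v}. f x = m * x + c"
    unfolding tropical_meromorphic_def by blast
  have cont: "isCont f x" for x
    using f unfolding tropical_meromorphic_def by (simp add: continuous_on_eq_continuous_at)
  show "\<forall>x. \<exists>m n. slopes_at f x m n"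
  proof
    fix x
    obtain d where d: "d > 0" "\<And>y. \<lbrakk>y \<in> S; y \<noteq> x\<rbrakk> \<Longrightarrow> d \<le> \<bar>y - x\<bar>"
      using S(1)[of x] unfolding islimpt_approachable dist_real_def by (meson not_less)
    have "{x<..<x + d} \<inter> S = {}" "{x - d<..<x} \<inter> S = {}" using d(2) by fastforce+
    then obtain n c m c' where r: "\<And>y. y \<in> {x<..<x + d} \<Longrightarrow> f y = n * y + c"
      and l: "\<And>y. y \<in> {x - d<..<x} \<Longrightarrow> f y = m * y + c'"
      using S(2) by meson
    have lim: "x islimpt {x<..<x + d}" "x islimpt {x - d<..<x}"
      using d(1) by (simp_all add: islimpt_greaterThanLessThan1 islimpt_greaterThanLessThan2)
    have "slopes_at f x m n"
    proof (rule slopes_atI[OF d(1)])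
      fix y assume "x \<le> y" "y < x + d"
      then show "f y = f x + n * (y - x)"
        using affine_extends_to_limit_point[OF cont lim(1) r] by (cases "x = y") auto
    next
      fix y assume "x - d < y" "y \<le> x"
      then show "f y = f x + m * (y - x)"
        using affine_extends_to_limit_point[OF cont lim(2) l] by (cases "x = y") auto
    qed
    then show "\<exists>m n. slopes_at f x m n" by blast
  qed
next
  assume *: "\<forall>x. \<exists>m n. slopes_at f x m n"
  \<comment> \<open>The exceptional set consists of exactly the genuine kinks; every other point
    close to \<open>x\<close> lies inside one of the two affine pieces at \<open>x\<close>.\<close>
  define S where "S = {x. \<nexists>m. slopes_at f x m m}"
  have "\<not> x islimpt S" for x
  proof -
    obtain m n where "slopes_at f x m n" using * by blast
    then obtain d where d: "d > 0"
      "\<And>y. \<lbrakk>x \<le> y; y < x + d\<rbrakk> \<Longrightarrow> f y = f x + n * (y - x)"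
      "\<And>y. \<lbrakk>x - d < y; y \<le> x\<rbrakk> \<Longrightarrow> f y = f x + m * (y - x)"
      using slopes_atE by blast
    have "y \<notin> S" if "y \<noteq> x" "dist y x < d" for y
    proof (cases "x < y")
      case True
      \<comment> \<open>This radius keeps the neighbourhood of \<open>y\<close> inside the
        right-hand piece between \<open>x\<close> and \<open>x + d\<close>.\<close>
      define e where "e = min (y - x) (x + d - y)"
      have e: "e > 0" using True that unfolding e_def dist_real_def by auto
      have fz: "f z = f y + n * (z - y)" if "y - e < z" "z < y + e" for z
      proof -
        have "x \<le> y" "y < x + d" "x \<le> z" "z < x + d"
          using that unfolding e_def by linarith+
        then show ?thesis using d(2)[of y] d(2)[of z] by (simp add: algebra_simps)
      qed
      have "slopes_at f y n n"
        by (rule slopes_atI[OF e]; rule fz; use e in linarith)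
      then show ?thesis unfolding S_def by blast
    next
      case False
      define e where "e = min (x - y) (y - (x - d))"
      have e: "e > 0" using False that unfolding e_def dist_real_def by auto
      have fz: "f z = f y + m * (z - y)" if "y - e < z" "z < y + e" for z
      proof -
        have "x - d < y" "y \<le> x" "x - d < z" "z \<le> x"
          using that unfolding e_def by linarith+
        then show ?thesis using d(3)[of y] d(3)[of z] by (simp add: algebra_simps)
      qed
      have "slopes_at f y m m"
        by (rule slopes_atI[OF e]; rule fz; use e in linarith)
      then show ?thesis unfolding S_def by blast
    qed
    then show ?thesis unfolding islimpt_approachable using d(1) by blast
  qed
  moreover have "\<exists>m c. \<forall>x\<in>{u<..<v}. f x = m * x + c" if "{u<..<v} \<inter> S = {}" for u v
  proof -
    have "\<And>x. x \<in> {u<..<v} \<Longrightarrow> \<exists>m. slopes_at f x m m" using that S_def by blast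
    then show ?thesis
      using affine_on_if_no_kinks[of "{u<..<v}" f]
      by (metis convex_real_interval(8) open_greaterThanLessThan)
  qed
  moreover have "continuous_on UNIV f"
    using * slopes_at_imp_isCont by (meson continuous_at_imp_continuous_on)
  ultimately show "tropical_meromorphic f" unfolding tropical_meromorphic_def by blast
qed

section \<open>Convexity of tropical entire functions\<close>

text \<open>Since \<open>tropical_omega f x\<close> is \<open>n - m\<close>, the absence of poles
  becomes an ordering of the slopes, the only form in which it is used below.\<close>

lemma tropical_entireE:
  assumes "tropical_entire f"
  obtains m n where "slopes_at f x m n" "m \<le> n"
proof -
  obtain m n where mn: "slopes_at f x m n"
    using assms unfolding tropical_entire_def tropical_meromorphic_iff_slopes_at by blast
  have "\<not> tropical_omega f x < 0"
    using assms unfolding tropical_entire_def tropical_pole_def by blast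
  with tropical_omega_eq[OF mn] that[OF mn] show thesis by simp
qed

text \<open>At the leftmost maximum point of \<open>f\<close> minus a chord, the slopes \<open>m \<le> n\<close> satisfy
  \<open>m \<ge> 0 \<ge> n\<close>, so the difference is constant nearby and the point is not leftmost.\<close>

lemma below_chord:
  assumes f: "\<And>x. \<exists>m n. slopes_at f x m n \<and> m \<le> n" and "u \<le> v"
    and "f u \<le> b + k * u" "f v \<le> b + k * v" "y \<in> {u..v}"
  shows "f y \<le> b + k * y"
proof (rule ccontr)
  define h where "h = (\<lambda>x. f x - k * x)"
  assume "\<not> f y \<le> b + k * y"
  then have hy: "h y > b" unfolding h_def by simp
  have h: "\<exists>m n. slopes_at h x m n \<and> m \<le> n" for x
  proof -
    obtain m n where "slopes_at f x m n" "m \<le> n" using f by blast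
    then have "slopes_at h x (m - k * 1) (n - k * 1)"
      unfolding h_def by (intro slopes_at_diff slopes_at_cmult slopes_at_ident)
    then show ?thesis using \<open>m \<le> n\<close> by fastforce
  qed
  then have conth: "continuous_on A h" for A
    using slopes_at_imp_isCont by (meson continuous_at_imp_continuous_on)
  obtain z where z: "z \<in> {u..v}" "\<And>x. x \<in> {u..v} \<Longrightarrow> h x \<le> h z"
    using continuous_attains_sup[of "{u..v}" h] conth \<open>u \<le> v\<close> by auto
  define K where "K = {u..v} \<inter> h -` {h z}"
  have "closed K" unfolding K_def
    by (intro continuous_closed_preimage conth) auto
  then have K: "compact K" unfolding K_def
    by (metis Int_lower1 bounded_closed_interval bounded_subset compact_eq_bounded_closed)
  have "K \<noteq> {}" using z unfolding K_def by blast
  from compact_attains_inf[OF K this]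
  obtain w where w: "w \<in> K" "\<And>x. x \<in> K \<Longrightarrow> w \<le> x" by auto
  have hw: "h w = h z" "w \<in> {u..v}" using w(1) unfolding K_def by auto
  \<comment> \<open>The maximum exceeds \<open>b\<close> while both end values do not, so
    \<open>w\<close> is an interior point.\<close>
  have "h u \<le> b" "h v \<le> b" using assms(3,4) unfolding h_def by auto
  moreover have "h w > b" using hy z(2)[OF assms(5)] hw by simp
  ultimately have "w \<noteq> u" "w \<noteq> v" by auto
  with hw have uv: "u < w" "w < v" by auto
  obtain m n where mn: "slopes_at h w m n" "m \<le> n" using h by blast
  obtain d where d: "d > 0"
    "\<And>y. \<lbrakk>w \<le> y; y < w + d\<rbrakk> \<Longrightarrow> h y = h w + n * (y - w)"
    "\<And>y. \<lbrakk>w - d < y; y \<le> w\<rbrakk> \<Longrightarrow> h y = h w + m * (y - w)"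
    using slopes_atE[OF mn(1)] by blast
  \<comment> \<open>Halving \<open>d\<close> makes \<open>e\<close> strictly smaller than
    \<open>d\<close>; the other two bounds keep \<open>w - e\<close> and \<open>w + e\<close> in the
    interval.\<close>
  define e where "e = min (d / 2) (min (w - u) (v - w))"
  have e: "e > 0" "e < d" "w - e \<in> {u..v}" "w + e \<in> {u..v}"
    using uv d(1) unfolding e_def by (auto simp: min_def)
  have "h (w + e) = h w + n * e" "h (w - e) = h w - m * e"
    using d(2)[of "w + e"] d(3)[of "w - e"] e by auto
  moreover have "h (w + e) \<le> h w" "h (w - e) \<le> h w" using z(2) e hw by auto
  ultimately have "n * e \<le> 0" "m * e \<ge> 0" by auto
  then have "n \<le> 0" "m \<ge> 0" using e(1) by (auto simp: mult_le_0_iff zero_le_mult_iff)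
  then have "m = 0" using mn(2) by simp
  then have "w - e \<in> K" using \<open>h (w - e) = h w - m * e\<close> e hw unfolding K_def by auto
  then show False using w(2) e(1) by force
qed

lemma convex_on_if_slopes_mono:
  assumes "\<And>x. \<exists>m n. slopes_at f x m n \<and> m \<le> n"
  shows "convex_on UNIV f"
proof (rule convex_on_linorderI)
  fix t x y :: real
  assume t: "0 < t" "t < 1" and xy: "x < y"
  define k where "k = (f y - f x) / (y - x)"
  have k: "k * (y - x) = f y - f x" unfolding k_def using xy by simp
  have mem: "(1 - t) * x + t * y \<in> {x..y}"
    using t xy convex_bound_le[of x y y "1 - t" t] mult_left_mono[of x y t]
    by (auto simp: algebra_simps)
  \<comment> \<open>The line with slope \<open>k\<close> and intercept \<open>f x - k * x\<close>
    passes through both end points of the graph.\<close>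
  have "f ((1 - t) * x + t * y) \<le> (f x - k * x) + k * ((1 - t) * x + t * y)"
    by (rule below_chord[OF assms, of x y]) (use k xy mem in \<open>auto simp: algebra_simps\<close>)
  also have "\<dots> = f x + t * (k * (y - x))" by (simp add: algebra_simps)
  also have "\<dots> = (1 - t) * f x + t * f y" unfolding k by (simp add: algebra_simps)
  finally show "f ((1 - t) *\<^sub>R x + t *\<^sub>R y) \<le> (1 - t) * f x + t * f y" by simp
qed auto

text \<open>Write \<open>v\<close> as a convex combination of \<open>u\<close> and a remote point
  \<open>w\<close>, with small weight \<open>t\<close> on \<open>w\<close>. As \<open>f w\<close> is
  bounded by \<open>a\<close>, letting \<open>t\<close> tend to 0 gives \<open>f v\<close> \<le>
  \<open>f u\<close>, and the roles are symmetric.\<close>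

lemma convex_on_bounded_above_imp_constant:
  fixes f :: "real \<Rightarrow> real"
  assumes "convex_on UNIV f" "\<And>x. f x \<le> a"
  shows "f x = f y"
proof -
  have le: "f v \<le> f u" for u v
  proof (rule field_le_epsilon)
    fix e :: real assume "e > 0"
    \<comment> \<open>The summand 1 keeps the denominator positive even if \<open>f u = a\<close>;
      the cap 1/2 keeps \<open>t\<close> below 1.\<close>
    define t where "t = min (1 / 2) (e / (a - f u + 1))"
    have pos: "a - f u + 1 > 0" using assms(2)[of u] by simp
    have t: "0 < t" "t < 1" unfolding t_def using pos \<open>e > 0\<close> by auto
    have "t \<le> e / (a - f u + 1)" unfolding t_def by simp
    then have te: "t * (a - f u + 1) \<le> e" using pos_le_divide_eq[OF pos] by blast
    define w where "w = u + (v - u) / t"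
    have "(1 - t) * u + t * w = v" unfolding w_def using t by (simp add: field_simps)
    then have "f v \<le> (1 - t) * f u + t * f w"
      using convex_onD[OF assms(1), of t u w] t by simp
    also have "\<dots> \<le> (1 - t) * f u + t * a" using assms(2) t by simp
    also have "\<dots> = f u + t * (a - f u + 1) - t" by (simp add: algebra_simps)
    also have "\<dots> \<le> f u + e" using te t by simp
    finally show "f v \<le> f u + e" .
  qed
  show ?thesis using le[of x y] le[of y x] by simp
qed

section \<open>The function \<open>Psi\<close> and periodicity\<close>

text \<open>At an integer \<open>x\<close> the left slope is \<open>x\<close>; at any other point both slopes are
  \<open>\<lfloor>x\<rfloor> + 1 = \<lceil>x\<rceil>\<close>.\<close>

lemma slopes_at_Psi: "slopes_at Psi x (of_int \<lceil>x\<rceil>) (of_int \<lfloor>x\<rfloor> + 1)"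
proof -
  \<comment> \<open>These are the distances from \<open>x\<close> to the nearest integers strictly
    to its right and strictly to its left; at an integer both are 1.\<close>
  define d where "d = min (of_int \<lfloor>x\<rfloor> + 1 - x) (x - (of_int \<lceil>x\<rceil> - 1))"
  have "d > 0" unfolding d_def by linarith
  then show ?thesis
  proof (rule slopes_atI)
    fix y assume y: "x \<le> y" "y < x + d"
    then have "\<lfloor>y\<rfloor> = \<lfloor>x\<rfloor>" unfolding d_def by linarith
    then show "Psi y = Psi x + (of_int \<lfloor>x\<rfloor> + 1) * (y - x)"
      unfolding Psi_def by (simp add: algebra_simps)
  next
    fix y assume y: "x - d < y" "y \<le> x"
    show "Psi y = Psi x + of_int \<lceil>x\<rceil> * (y - x)"
    proof (cases "x \<in> \<int>")
      case True
      then obtain k where k: "x = of_int k" by (auto elim: Ints_cases)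
      \<comment> \<open>The floor drops to \<open>k - 1\<close> left of \<open>k\<close>, but the
        two formulas for \<open>Psi\<close> agree at \<open>k\<close>.\<close>
      have "\<lfloor>y\<rfloor> = (if y = x then k else k - 1)" using y unfolding d_def k
        by (auto simp: floor_eq_iff)
      then show ?thesis unfolding Psi_def k by (auto simp: algebra_simps)
    next
      case False
      then have "\<lceil>x\<rceil> = \<lfloor>x\<rfloor> + 1" by (simp add: ceiling_altdef Ints_def image_iff)
      moreover from this have "\<lfloor>y\<rfloor> = \<lfloor>x\<rfloor>" using y unfolding d_def by linarith
      ultimately show ?thesis unfolding Psi_def by (simp add: algebra_simps)
    qed
  qed
qed

lemma Psi_plus_one: "Psi (x + 1) = Psi x + x + 1"
  unfolding Psi_def by (simp add: algebra_simps)

lemma periodic_plus_int: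
  fixes g :: "real \<Rightarrow> 'a"
  assumes "\<And>x. g (x + 1) = g x"
  shows "g (x + of_int k) = g x"
proof (induction k rule: int_induct[where k = 0])
  case (step1 i)
  then show ?case using assms[of "x + of_int i"] by (simp add: algebra_simps)
next
  case (step2 i)
  then show ?case using assms[of "x + of_int (i - 1)"] by (simp add: algebra_simps)
qed simp

section \<open>The shift equation for the truncated function and the two cases at infinity\<close>

theorem theorem8p1:
  fixes f :: "real \<Rightarrow> real" and a :: real
  assumes "tropical_entire f"
    and "same_roots_with_multiplicities (\<lambda>x. max (f (x + 1)) a) (\<lambda>x. max (f x) a)"
  shows "\<exists>(A::real) (B::real) (P::real \<Rightarrow> real).
           tropical_meromorphic P \<and> (\<forall>x. P (x + 1) = P x) \<and>
           ((\<forall>\<^sub>F x in at_bot. f x = P x + B * x) \<or>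
            (\<forall>\<^sub>F x in at_top. f x = P x + B * x) \<or>
            (\<forall>\<^sub>F x in at_infinity. f x = A * Psi x + P x + (B - A) * x))"
proof -
  have f: "\<exists>m n. slopes_at f x m n \<and> m \<le> n" for x
    using tropical_entireE[OF assms(1)] by metis
  define g where "g = (\<lambda>x. max (f x) a)"
  have g: "\<exists>m n. slopes_at g x m n \<and> m \<le> n" for x
    using f[of x] slopes_at_max_const[of f x _ _ a] unfolding g_def by metis
  have kink: "\<exists>m. slopes_at (\<lambda>x. g (x + 1) - g x) x m m" for x
  proof -
    obtain m n m' n' where 1: "slopes_at g x m n" "m \<le> n"
      and 2: "slopes_at g (x + 1) m' n'" "m' \<le> n'" using g by meson
    note 3 = slopes_at_shift[OF 2(1)]
    have "tropical_root (\<lambda>x. g (x + 1)) x k \<longleftrightarrow> tropical_root g x k" for k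
      using assms(2) unfolding same_roots_with_multiplicities_def g_def by blast
    \<comment> \<open>Roots only record positive values, but both differences are non-negative, so
      without a root both are 0.\<close>
    then have "n' - m' = n - m"
      unfolding tropical_root_def tropical_omega_eq[OF 1(1)] tropical_omega_eq[OF 3]
      using 1(2) 2(2) by (metis diff_ge_0_iff_ge order_le_less)
    then have "m' - m = n' - n" by simp
    then show ?thesis using slopes_at_diff[OF 3 1(1)] by metis
  qed
  then obtain \<alpha> \<beta> where "\<And>x. g (x + 1) - g x = \<alpha> * x + \<beta>"
    using affine_on_if_no_kinks[of UNIV "\<lambda>x. g (x + 1) - g x"] by auto
  then have step: "g (x + 1) = g x + \<alpha> * x + \<beta>" for x
    by (metis add.assoc add.commute diff_add_cancel)
  show ?thesis
  proof (cases "\<forall>\<^sub>F x in at_infinity. f x > a")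
    case True
    \<comment> \<open>\<open>Psi\<close> absorbs \<alpha> x + \<alpha> of the increment \<alpha> x +
      \<beta>; the linear term absorbs the remaining \<beta> - \<alpha>. Thus A = \<alpha> and B =
      \<beta>.\<close>
    define P where "P = (\<lambda>x. g x - \<alpha> * Psi x - (\<beta> - \<alpha>) * x)"
    have "\<exists>m n. slopes_at P x m n" for x
    proof -
      obtain m n where "slopes_at g x m n" using g by blast
      from slopes_at_diff[OF slopes_at_diff[OF this slopes_at_cmult[OF slopes_at_Psi]]
          slopes_at_cmult[OF slopes_at_ident]]
      show ?thesis unfolding P_def by blast
    qed
    then have "tropical_meromorphic P" by (simp add: tropical_meromorphic_iff_slopes_at)
    moreover have "\<forall>x. P (x + 1) = P x"
      unfolding P_def by (simp add: step Psi_plus_one algebra_simps)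
    moreover have "\<forall>\<^sub>F x in at_infinity. f x = \<alpha> * Psi x + P x + (\<beta> - \<alpha>) * x"
      using True by (rule eventually_mono) (simp add: P_def g_def)
    ultimately show ?thesis by blast
  next
    case False
    \<comment> \<open>The chord taken here is the horizontal line at height \<open>a\<close>, so the
      sublevel set is an interval.\<close>
    have between: "f x \<le> a" if "f u \<le> a" "f v \<le> a" "u \<le> x" "x \<le> v" for u v x
      using below_chord[of f u v a 0 x] f that by auto
    have "\<not> (\<forall>\<^sub>F x in at_bot. f x > a) \<or> \<not> (\<forall>\<^sub>F x in at_top. f x > a)"
      using False by (auto simp: at_infinity_eq_at_top_bot eventually_sup)
    \<comment> \<open>Length 2 accommodates \<open>q\<close>, \<open>q + 1\<close> and
      \<open>q + 2\<close>, hence two instances of \<open>step\<close>. Points with f \<le>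
      \<open>a\<close> occur arbitrarily far in one direction, so two of them can be chosen at least
      2 apart.\<close>
    then obtain q where q: "\<And>x. x \<in> {q..q + 2} \<Longrightarrow> f x \<le> a"
    proof
      assume "\<not> (\<forall>\<^sub>F x in at_bot. f x > a)"
      then have low: "\<exists>u\<le>N. f u \<le> a" for N
        unfolding eventually_at_bot_linorder by (meson not_less)
      obtain v where v: "f v \<le> a" using low by blast
      obtain u where "u \<le> v - 2" "f u \<le> a" using low by blast
      then show thesis using that[of "v - 2"] between[of u v] v by simp
    next
      assume "\<not> (\<forall>\<^sub>F x in at_top. f x > a)"
      then have high: "\<exists>u\<ge>N. f u \<le> a" for N
        unfolding eventually_at_top_linorder by (meson not_less)
      obtain v where v: "f v \<le> a" using high by blast
      obtain u where "u \<ge> v + 2" "f u \<le> a" using high by blast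
      then show thesis using that[of v] between[of v u] v by simp
    qed
    then have ga: "g x = a" if "x \<in> {q..q + 2}" for x
      using that unfolding g_def by (simp add: max_absorb2)
    have "\<alpha> * q + \<beta> = 0" "\<alpha> * (q + 1) + \<beta> = 0"
      using step[of q] step[of "q + 1"] ga[of q] ga[of "q + 1"] ga[of "q + 2"]
      by (simp_all add: add.assoc)
    then have "\<alpha> = 0" "\<beta> = 0" by (auto simp: algebra_simps)
    then have per: "g (x + 1) = g x" for x using step by simp
    have "f x \<le> a" for x
    proof -
      \<comment> \<open>The integer shift by the ceiling of \<open>q - x\<close> lands in the
        half-open interval from \<open>q\<close> to \<open>q + 1\<close>.\<close>
      have "x + of_int \<lceil>q - x\<rceil> \<in> {q..q + 2}" by (simp; linarith)
      then have "g x = a" using ga periodic_plus_int[of g, OF per] by metis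
      then show ?thesis unfolding g_def by (metis max.cobounded1)
    qed
    then have const: "f x = f 0" for x
      using convex_on_bounded_above_imp_constant convex_on_if_slopes_mono f by blast
    \<comment> \<open>A constant f satisfies alternative (a) with A = B = 0 and itself as the
      periodic part.\<close>
    have "tropical_meromorphic (\<lambda>x. f 0)"
      unfolding tropical_meromorphic_iff_slopes_at using slopes_at_const by blast
    moreover have "\<forall>\<^sub>F x in at_bot. f x = f 0 + 0 * x" using const by simp
    ultimately show ?thesis by (intro exI[of _ 0] exI[of _ "\<lambda>x. f 0"]) simp
  qed
qed

end
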